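(* Let $M=\mathbb{H}^n_k$ be the hyperbolic space of dimension $n\ge 2$ and constant sectional curvature $-k^2$, where $k>0$, and let $p\in M$. If $f:M\to\mathbb{R}$ is differentiable at $p$, then $$\partial B^p f(p)=\begin{cases}\{0_p\}, & \text{if } p\in\operatorname*{argmin}_{z\in M}f(z),\\ \varnothing, & \text{if } p\notin\operatorname*{argmin}_{z\in M}f(z),\end{cases}$$ where $0_p$ denotes the zero vector of $T_pM$.
   Context: $\mathbb{H}^n_k$ is the complete, simply connected $n$-dimensional Riemannian manifold of constant sectional curvature $-k^2$; $d$ is its Riemannian distance and $\exp$ its exponential map (each $\exp_p$ is a diffeomorphism). For $q\in M$ and a unit vector $u\in T_qM$, $\gamma_{(q,u)}(t)=\exp_q(tu)$, $t\ge 0$, is the unit-speed geodesic ray from $q$ in direction $u$, and $B_u^q(x)=\lim_{t\to+\infty}\bigl(d(x,\gamma_{(q,u)}(t))-t\bigr)$ is the Busemann function. For a nonzero $u\in T_qM$, $B_u^q:=B_{u/\|u\|}^q$. Two unit-speed rays $\gamma,\sigma$ are asymptotic if $t\mapsto d(\gamma(t),\sigma(t))$ is bounded on $[0,\infty)$; for each ray and each point $q$ there is exactly one ray from $q$ asymptotic to it. Busemann coupling with base point $p$: $H_p:M\times M\to\mathbb{R}$, $H_p(z,y)=d(p,z)\,B^p_{-\exp_p^{-1}z}(y)$ if $z\ne p$, and $H_p(p,y)=0$. For $x\in M$ and $v\in T_xM\setminus\{0\}$, $\eta_{p,x}(v)\in T_pM$ is the unique unit vector such that $\gamma_{(p,\eta_{p,x}(v))}$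 and $\gamma_{(x,-v/\|v\|)}$ are asymptotic; $Y_p(x,v):=\exp_p(-\|v\|\,\eta_{p,x}(v))$ for $v\neq 0$ and $Y_p(x,0):=p$. $B^p$-subdifferential: $\partial B^p f(x)$ is the set of all $v\in T_xM$ such that $f(z)\ge f(x)+H_p(z,Y_p(x,v))-H_p(x,Y_p(x,v))$ for all $z\in M$. *)

theory Defs
  imports "HOL-Analysis.Analysis"
begin

text \<open>
  The complete, simply connected \<open>n\<close>-manifold of constant sectional curvature \<open>-k\<^sup>2\<close> is realised
  as the upper sheet of the hyperboloid \<open>\<langle>x, x\<rangle> = -1/k\<^sup>2\<close> in Minkowski space \<open>\<real> \<times> \<real>\<^sup>n\<close> (the first
  component being the time coordinate), with the Riemannian metric induced by the Minkowski form.
  Tangent vectors are vectors of the ambient space; \<open>n\<close> is \<open>CARD('n)\<close>.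
\<close>

type_synonym 'n minkowski = "real \<times> (real ^ 'n)"

definition mink :: "'n::finite minkowski \<Rightarrow> 'n minkowski \<Rightarrow> real" where
  "mink x y = snd x \<bullet> snd y - fst x * fst y"

definition hyp_space :: "real \<Rightarrow> ('n::finite minkowski) set" where
  "hyp_space k = {x. mink x x = - 1 / k\<^sup>2 \<and> fst x > 0}"

definition tangent :: "'n::finite minkowski \<Rightarrow> ('n minkowski) set" where
  "tangent x = {v. mink x v = 0}"

text \<open>The Minkowski form is positive definite on each tangent space of the hyperboloid.\<close>

definition tnorm :: "'n::finite minkowski \<Rightarrow> real" where
  "tnorm v = sqrt (mink v v)"

definition normalize_vec :: "'n::finite minkowski \<Rightarrow> 'n minkowski" where
  "normalize_vec v = (1 / tnorm v) *\<^sub>R v"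

definition curve_length :: "(real \<Rightarrow> 'n::finite minkowski) \<Rightarrow> real" where
  "curve_length c = integral {0..1} (\<lambda>t. tnorm (vector_derivative c (at t)))"

text \<open>
  \<open>piecewise_C1_differentiable_on\<close> allows the derivative to be unbounded near an exceptional point, so
  integrability of the speed is required: otherwise \<open>integral\<close> would give the value 0 to a
  curve of infinite length.
\<close>

definition hdist :: "real \<Rightarrow> 'n::finite minkowski \<Rightarrow> 'n minkowski \<Rightarrow> real" where
  "hdist k x y = Inf {curve_length c | c.
     c piecewise_C1_differentiable_on {0..1} \<and>
     (\<lambda>t. tnorm (vector_derivative c (at t))) integrable_on {0..1} \<and> path_image c \<subseteq> hyp_space k \<and>
     pathstart c = x \<and> pathfinish c = y}"

text \<open>
  Orthogonal projection onto the tangent space at \<open>x\<close>. The Levi-Civita covariant derivative of the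
  velocity of a curve in the hyperboloid is the tangential projection of its ambient acceleration.
\<close>

definition tangent_proj :: "real \<Rightarrow> 'n::finite minkowski \<Rightarrow> 'n minkowski \<Rightarrow> 'n minkowski" where
  "tangent_proj k x w = w + (k\<^sup>2 * mink x w) *\<^sub>R x"

definition is_geodesic :: "real \<Rightarrow> (real \<Rightarrow> 'n::finite minkowski) \<Rightarrow> bool" where
  "is_geodesic k c \<longleftrightarrow> (\<forall>t. c t \<in> hyp_space k) \<and>
     (\<exists>c' c''. \<forall>t. (c has_vector_derivative c' t) (at t) \<and>
                   (c' has_vector_derivative c'' t) (at t) \<and>
                   tangent_proj k (c t) (c'' t) = 0)"

definition hexp :: "real \<Rightarrow> 'n::finite minkowski \<Rightarrow> 'n minkowski \<Rightarrow> 'n minkowski" where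
  "hexp k q v = (THE y. \<exists>c. is_geodesic k c \<and> c 0 = q \<and>
                            (c has_vector_derivative v) (at 0) \<and> c 1 = y)"

definition hlog :: "real \<Rightarrow> 'n::finite minkowski \<Rightarrow> 'n minkowski \<Rightarrow> 'n minkowski" where
  "hlog k q = the_inv_into (tangent q) (hexp k q)"

definition ray :: "real \<Rightarrow> 'n::finite minkowski \<Rightarrow> 'n minkowski \<Rightarrow> real \<Rightarrow> 'n minkowski" where
  "ray k q u t = hexp k q (t *\<^sub>R u)"

definition busemann :: "real \<Rightarrow> 'n::finite minkowski \<Rightarrow> 'n minkowski \<Rightarrow> 'n minkowski \<Rightarrow> real" where
  "busemann k q u x = Lim at_top (\<lambda>t. hdist k x (ray k q (normalize_vec u) t) - t)"

definition asymptotic ::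
  "real \<Rightarrow> (real \<Rightarrow> 'n::finite minkowski) \<Rightarrow> (real \<Rightarrow> 'n minkowski) \<Rightarrow> bool" where
  "asymptotic k c d \<longleftrightarrow> bounded ((\<lambda>t. hdist k (c t) (d t)) ` {0..})"

definition busemann_coupling ::
  "real \<Rightarrow> 'n::finite minkowski \<Rightarrow> 'n minkowski \<Rightarrow> 'n minkowski \<Rightarrow> real" where
  "busemann_coupling k p z y =
     (if z = p then 0 else hdist k p z * busemann k p (- hlog k p z) y)"

definition asymptotic_dir ::
  "real \<Rightarrow> 'n::finite minkowski \<Rightarrow> 'n minkowski \<Rightarrow> 'n minkowski \<Rightarrow> 'n minkowski" where
  "asymptotic_dir k p x v =
     (THE u. u \<in> tangent p \<and> tnorm u = 1 \<and>
             asymptotic k (ray k p u) (ray k x (- normalize_vec v)))"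

definition busemann_point ::
  "real \<Rightarrow> 'n::finite minkowski \<Rightarrow> 'n minkowski \<Rightarrow> 'n minkowski \<Rightarrow> 'n minkowski" where
  "busemann_point k p x v =
     (if v = 0 then p else hexp k p (- (tnorm v *\<^sub>R asymptotic_dir k p x v)))"

definition busemann_subdiff ::
  "real \<Rightarrow> 'n::finite minkowski \<Rightarrow> ('n minkowski \<Rightarrow> real) \<Rightarrow> 'n minkowski \<Rightarrow> ('n minkowski) set" where
  "busemann_subdiff k p f x =
     {v \<in> tangent x. \<forall>z \<in> hyp_space k.
        f z \<ge> f x + busemann_coupling k p z (busemann_point k p x v)
                  - busemann_coupling k p x (busemann_point k p x v)}"

end

(* At the base point, Y_p(p, v) = exp_p v.  If v is nonzero, choose a unit vector w orthogonal to v
   (possible since n >= 2).  The Busemann functions of both w and -w take the same positive value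
   beta = ln (cosh (k |v|)) / k at exp_p v, so v in the subdifferential would give
   f (exp_p (t w)) >= f p + |t| beta for all real t, which contradicts differentiability at p.
   For v = 0 the coupling term vanishes identically. *)

theory Submission
  imports Defs "HOL-Real_Asymp.Real_Asymp"
begin

section \<open>The Minkowski form\<close>

text \<open>The two Busemann values agree by symmetry: \<open>exp_p v\<close> lies on the totally
  geodesic hyperplane through \<open>p\<close> normal to \<open>w\<close>. There the hyperbolic
  Pythagorean theorem gives cosh (k d) = cosh (k |v|) cosh (k t) for the distance d to the point at
  time t on either ray, and arcosh (a cosh s) - s tends to ln a. Positivity of the value is an
  effect of negative curvature: it is about k |v|^2 / 2 for small k. In the flat limit it vanishes,
  the coupling becomes the inner product and the argument breaks down. On a line the coupling is
  likewise the ordinary product, and no \<open>w\<close> exists. The obstacle is that the objects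
  are specified by \<open>THE\<close>, \<open>Inf\<close>, \<open>Lim\<close> or an inverse, so each
  needs an existence or uniqueness proof before it has a value. All of them are evaluated through
  the explicit curve \<open>geo\<close>. The only estimate over arbitrary curves is the lower bound
  on lengths behind \<open>hdist\<close>; it comes from horofunctions.\<close>

interpretation mink: bounded_bilinear "mink :: 'n::finite minkowski \<Rightarrow> 'n minkowski \<Rightarrow> real"
proof
  fix a a' b b' :: "'n minkowski" and r :: real
  show "mink (a + a') b = mink a b + mink a' b" "mink a (b + b') = mink a b + mink a b'"
    "mink (r *\<^sub>R a) b = r *\<^sub>R mink a b" "mink a (r *\<^sub>R b) = r *\<^sub>R mink a b"
    by (simp_all add: mink_def inner_add_left inner_add_right algebra_simps)
  have "norm (mink a b) \<le> norm a * norm b * 2" for a b :: "'n minkowski"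
  proof -
    have "\<bar>snd a \<bullet> snd b\<bar> \<le> norm a * norm b"
      by (rule order_trans[OF Cauchy_Schwarz_ineq2]) (metis norm_snd_le mult_mono norm_ge_zero prod.collapse)
    moreover have "\<bar>fst a * fst b\<bar> \<le> norm a * norm b"
      unfolding abs_mult
      by (metis norm_fst_le mult_mono norm_ge_zero prod.collapse real_norm_def)
    ultimately show ?thesis by (simp add: mink_def abs_le_iff)
  qed
  then show "\<exists>K. \<forall>a b :: 'n minkowski. norm (mink a b) \<le> norm a * norm b * K" by blast
qed

lemmas mink_simps = mink.add_left mink.add_right mink.diff_left mink.diff_right
  mink.minus_left mink.minus_right mink.scaleR_left mink.scaleR_right mink.zero_left mink.zero_right

lemma mink_commute: "mink x y = mink y x"
  by (simp add: mink_def inner_commute mult.commute)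

lemma hyp_space_iff: "x \<in> hyp_space k \<longleftrightarrow> mink x x = - 1 / k\<^sup>2 \<and> fst x > 0"
  by (simp add: hyp_space_def)

lemma tangent_iff: "v \<in> tangent x \<longleftrightarrow> mink x v = 0"
  by (simp add: tangent_def)

lemma hyp_norm_snd_less:
  assumes "k > 0" "x \<in> hyp_space k"
  shows "norm (snd x) < fst x"
proof -
  have "(norm (snd x))\<^sup>2 = (fst x)\<^sup>2 - 1 / k\<^sup>2"
    using assms by (simp add: hyp_space_iff mink_def power2_norm_eq_inner) (simp add: power2_eq_square)
  also have "\<dots> < (fst x)\<^sup>2" using assms by simp
  finally show ?thesis using assms by (simp add: hyp_space_iff power2_less_imp_less)
qed

text \<open>A vector orthogonal to a timelike vector is spacelike: Cauchy-Schwarz on the space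
  components, combined with \<open>norm (snd x) < fst x\<close>, makes the space part of
  \<open>v\<close> dominate its time part.\<close>

lemma tangent_mink_pos:
  assumes "k > 0" "x \<in> hyp_space k" "v \<in> tangent x" "v \<noteq> 0"
  shows "mink v v > 0"
proof -
  have n: "norm (snd x) < fst x" by (rule hyp_norm_snd_less[OF assms(1,2)])
  have f: "fst x > 0" using assms by (simp add: hyp_space_iff)
  have eq: "snd x \<bullet> snd v = fst x * fst v" using assms(3) by (simp add: tangent_iff mink_def)
  have le: "fst x * \<bar>fst v\<bar> \<le> norm (snd x) * norm (snd v)"
    using Cauchy_Schwarz_ineq2[of "snd x" "snd v"] f by (simp add: eq abs_mult)
  have "snd v \<noteq> 0" using eq f assms(4) by (auto simp: prod_eq_iff)
  then have "norm (snd x) * norm (snd v) < fst x * norm (snd v)" using n by simp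
  with le have "fst x * \<bar>fst v\<bar> < fst x * norm (snd v)" by linarith
  then have "\<bar>fst v\<bar> < norm (snd v)" using f by simp
  then have "\<bar>fst v\<bar>\<^sup>2 < (norm (snd v))\<^sup>2" by (intro power_strict_mono) auto
  then show ?thesis by (simp add: mink_def power2_norm_eq_inner) (simp add: power2_eq_square)
qed

lemma tangent_mink_nonneg:
  assumes "k > 0" "x \<in> hyp_space k" "v \<in> tangent x"
  shows "mink v v \<ge> 0"
  using tangent_mink_pos[OF assms] by (cases "v = 0") (auto simp: mink_simps)

lemma tnorm_pos:
  assumes "k > 0" "x \<in> hyp_space k" "v \<in> tangent x" "v \<noteq> 0"
  shows "tnorm v > 0"
  using tangent_mink_pos[OF assms] by (simp add: tnorm_def)

lemma tnorm_zero [simp]: "tnorm 0 = 0"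
  by (simp add: tnorm_def mink_simps)

lemma tnorm_scaleR: "tnorm (r *\<^sub>R v) = \<bar>r\<bar> * tnorm v"
proof -
  have "mink (r *\<^sub>R v) (r *\<^sub>R v) = r\<^sup>2 * mink v v" by (simp add: mink_simps power2_eq_square)
  then show ?thesis by (simp add: tnorm_def real_sqrt_mult)
qed

lemma tnorm_minus: "tnorm (- v) = tnorm v"
  by (simp add: tnorm_def mink_simps)

lemma tnorm_sq:
  assumes "k > 0" "x \<in> hyp_space k" "v \<in> tangent x"
  shows "(tnorm v)\<^sup>2 = mink v v"
  using tangent_mink_nonneg[OF assms] by (simp add: tnorm_def)

lemma tangent_scaleR: "v \<in> tangent x \<Longrightarrow> r *\<^sub>R v \<in> tangent x"
  by (simp add: tangent_iff mink_simps)

lemma tangent_minus: "v \<in> tangent x \<Longrightarrow> - v \<in> tangent x"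
  by (simp add: tangent_iff mink_simps)

lemma tnorm_normalize_vec:
  assumes "k > 0" "x \<in> hyp_space k" "v \<in> tangent x" "v \<noteq> 0"
  shows "tnorm (normalize_vec v) = 1"
  using tnorm_pos[OF assms] by (simp add: normalize_vec_def tnorm_scaleR)

lemma tangent_normalize_vec: "v \<in> tangent x \<Longrightarrow> normalize_vec v \<in> tangent x"
  by (simp add: normalize_vec_def tangent_scaleR)

text \<open>The form is indefinite on the ambient space, so the classical argument is run with
  positivity on the tangent space only, applied to \<open>mink w w\<close> times \<open>v\<close>
  minus \<open>mink v w\<close> times \<open>w\<close>.\<close>

lemma tangent_Cauchy_Schwarz:
  assumes "k > 0" "x \<in> hyp_space k" "v \<in> tangent x" "w \<in> tangent x"
  shows "(mink v w)\<^sup>2 \<le> mink v v * mink w w"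
proof (cases "w = 0")
  case True
  then show ?thesis by (simp add: mink_simps)
next
  case False
  define a b c where "a = mink w w" and "b = mink v w" and "c = mink v v"
  have pos: "a > 0" unfolding a_def using False by (intro tangent_mink_pos[OF assms(1,2,4)])
  have "a *\<^sub>R v - b *\<^sub>R w \<in> tangent x"
    using assms(3,4) by (simp add: tangent_iff mink_simps)
  then have "0 \<le> mink (a *\<^sub>R v - b *\<^sub>R w) (a *\<^sub>R v - b *\<^sub>R w)"
    by (rule tangent_mink_nonneg[OF assms(1,2)])
  also have "\<dots> = a * (c * a - b\<^sup>2)"
    using mink_commute[of w v]
    by (simp add: mink_simps a_def b_def c_def algebra_simps power2_eq_square)
  finally have "0 \<le> c * a - b\<^sup>2" using pos by (simp add: zero_le_mult_iff)
  then show ?thesis by (simp add: a_def b_def c_def)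
qed

lemma hyp_mink_less_zero:
  assumes "k > 0" "x \<in> hyp_space k" "y \<in> hyp_space k"
  shows "mink x y < 0"
proof -
  have "snd x \<bullet> snd y \<le> norm (snd x) * norm (snd y)" by (rule norm_cauchy_schwarz)
  also have "\<dots> < fst x * fst y"
    using hyp_norm_snd_less[OF assms(1,2)] hyp_norm_snd_less[OF assms(1,3)]
    by (intro mult_strict_mono') auto
  finally show ?thesis by (simp add: mink_def)
qed

text \<open>The quadratic equation leaves two sheets. A negative product with one point of the upper
  sheet excludes the lower sheet, whose negatives would have the same sign by
  \<open>hyp_mink_less_zero\<close>.\<close>

lemma hyp_spaceI:
  assumes "k > 0" "x \<in> hyp_space k" "mink y y = - 1 / k\<^sup>2" "mink x y < 0"
  shows "y \<in> hyp_space k"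
proof -
  have "fst y \<noteq> 0"
  proof
    assume "fst y = 0"
    then have "mink y y \<ge> 0" by (simp add: mink_def)
    then show False using assms(1,3) by (simp add: divide_simps)
  qed
  moreover have "\<not> fst y < 0"
  proof
    assume "fst y < 0"
    then have "- y \<in> hyp_space k" using assms(3) by (simp add: hyp_space_iff mink_simps)
    from hyp_mink_less_zero[OF assms(1,2) this] assms(4) show False by (simp add: mink_simps)
  qed
  ultimately show ?thesis using assms(3) by (simp add: hyp_space_iff)
qed

section \<open>Geodesics and the exponential map\<close>

text \<open>For a unit tangent vector \<open>u\<close> this is the unit-speed geodesic, the solution
  of c'' = k^2 c with c(0) = p and c'(0) = u.\<close>

definition geo :: "real \<Rightarrow> 'n::finite minkowski \<Rightarrow> 'n minkowski \<Rightarrow> real \<Rightarrow> 'n minkowski" where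
  "geo k p u t = cosh (k * t) *\<^sub>R p + (sinh (k * t) / k) *\<^sub>R u"

lemma geo_0 [simp]: "geo k p u 0 = p"
  by (simp add: geo_def)

lemma cosh_sq_minus_sinh_sq: "(cosh x)\<^sup>2 - (sinh x)\<^sup>2 = (1 :: real)"
  using hyperbolic_pythagoras[of x] by simp

text \<open>For unit vectors this is the hyperbolic law of cosines at \<open>p\<close>, with
  \<open>mink u u'\<close> the cosine of the angle; \<open>hdist_eq\<close> later identifies the
  left side as cosh of k times the distance.\<close>

lemma mink_geo_geo:
  assumes "k > 0" "p \<in> hyp_space k" "u \<in> tangent p" "u' \<in> tangent p"
  shows "- k\<^sup>2 * mink (geo k p u s) (geo k p u' t) =
    cosh (k * s) * cosh (k * t) - sinh (k * s) * sinh (k * t) * mink u u'"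
proof -
  have "mink p p = - 1 / k\<^sup>2" "mink p u = 0" "mink p u' = 0" "mink u p = 0" "mink u' p = 0"
    using assms mink_commute[of p u] mink_commute[of p u'] by (auto simp: hyp_space_iff tangent_iff)
  then show ?thesis using assms(1)
    by (simp add: geo_def mink_simps) (simp add: power2_eq_square field_simps)
qed

lemma unit_tangent_mink:
  assumes "tnorm u = 1"
  shows "mink u u = 1"
  using assms by (simp add: tnorm_def)

lemma geo_in_hyp:
  assumes "k > 0" "p \<in> hyp_space k" "u \<in> tangent p" "tnorm u = 1"
  shows "geo k p u t \<in> hyp_space k"
proof (rule hyp_spaceI[OF assms(1,2)])
  have "- k\<^sup>2 * mink (geo k p u t) (geo k p u t) = 1"
    using mink_geo_geo[OF assms(1,2,3,3), of t t] cosh_sq_minus_sinh_sq[of "k * t"]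
    by (simp add: unit_tangent_mink[OF assms(4)] power2_eq_square)
  then show "mink (geo k p u t) (geo k p u t) = - 1 / k\<^sup>2"
    using assms(1) by (simp add: field_simps)
  have "- k\<^sup>2 * mink p (geo k p u t) = cosh (k * t)"
    using mink_geo_geo[OF assms(1,2,3,3), of 0 t] by simp
  then have "k\<^sup>2 * mink p (geo k p u t) < 0"
    using cosh_real_pos[of "k * t"] by linarith
  then show "mink p (geo k p u t) < 0"
    using assms(1) by (simp add: mult_less_0_iff)
qed

lemma geo_has_vector_derivative:
  assumes "k > 0"
  shows "(geo k p u has_vector_derivative
    (k * sinh (k * t)) *\<^sub>R p + cosh (k * t) *\<^sub>R u) (at t within S)"
  unfolding geo_def[abs_def] using assms
  by (auto intro!: derivative_eq_intros simp: has_vector_derivative_def fun_eq_iff algebra_simps)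

lemma geo_second_derivative:
  assumes "k > 0"
  shows "((\<lambda>t. (k * sinh (k * t)) *\<^sub>R p + cosh (k * t) *\<^sub>R u) has_vector_derivative
    k\<^sup>2 *\<^sub>R geo k p u t) (at t within S)"
  unfolding geo_def[abs_def] using assms
  by (auto intro!: derivative_eq_intros
      simp: has_vector_derivative_def fun_eq_iff algebra_simps power2_eq_square)

lemma const_of_vector_derivative_0:
  fixes g :: "real \<Rightarrow> 'a::real_normed_vector"
  assumes "\<And>t. (g has_vector_derivative 0) (at t)"
  shows "g t = g 0"
  using has_derivative_zero_unique[of UNIV g]  assms
  by (auto simp: has_vector_derivative_def)

text \<open>The operator factors as (D + a)(D - a). Integrating factors exp (a t) and exp (- a t)
  show first that e' - a e vanishes, then that e does.\<close>

lemma linear_ode_unique: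
  fixes e :: "real \<Rightarrow> 'a::real_normed_vector"
  assumes e1: "\<And>t. (e has_vector_derivative e' t) (at t)"
    and e2: "\<And>t. (e' has_vector_derivative a\<^sup>2 *\<^sub>R e t) (at t)"
    and init: "e 0 = 0" "e' 0 = 0"
  shows "e t = 0"
proof -
  have "((\<lambda>t. exp (a * t) *\<^sub>R (e' t - a *\<^sub>R e t)) has_vector_derivative 0) (at t)" for t
    by (rule has_vector_derivative_eq_rhs,
       (rule has_vector_derivative_scaleR has_vector_derivative_diff e1 e2 
          bounded_linear.has_vector_derivative[OF bounded_linear_scaleR_right] derivative_eq_intros refl)+)
      (auto simp: algebra_simps power2_eq_square)
  from const_of_vector_derivative_0[OF this] have A: "e' t = a *\<^sub>R e t" for t
    by (simp add: init)
  have "((\<lambda>t. exp (- a * t) *\<^sub>R e t) has_vector_derivative 0) (at t)" for t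
    by (rule has_vector_derivative_eq_rhs,
       (rule has_vector_derivative_scaleR e1 derivative_eq_intros refl)+)
      (auto simp: algebra_simps A)
  from const_of_vector_derivative_0[OF this] show ?thesis by (simp add: init)
qed

text \<open>Differentiating the equation of the hyperboloid twice fixes the normal part of the
  acceleration, and the geodesic equation kills the rest. The speed is constant because the
  acceleration is then a multiple of \<open>c t\<close>, which is orthogonal to the velocity. The
  geodesic equation thus becomes linear with constant coefficients.\<close>

lemma geodesic_second_derivative:
  assumes "k > 0" and hyp: "\<And>t. c t \<in> hyp_space k"
    and c1: "\<And>t. (c has_vector_derivative c' t) (at t)"
    and c2: "\<And>t. (c' has_vector_derivative c'' t) (at t)"
    and proj: "\<And>t. tangent_proj k (c t) (c'' t) = 0"
  shows "c'' t = (k\<^sup>2 * mink (c' 0) (c' 0)) *\<^sub>R c t"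
proof -
  have "mink (c t) (c' t) = 0" for t
  proof -
    have "((\<lambda>t. mink (c t) (c t)) has_vector_derivative mink (c t) (c' t) + mink (c' t) (c t)) (at t)"
      by (rule mink.has_vector_derivative[OF c1 c1])
    moreover have "(\<lambda>t. mink (c t) (c t)) = (\<lambda>t. - 1 / k\<^sup>2)"
      using hyp by (simp add: hyp_space_iff)
    ultimately show ?thesis
      using vector_derivative_unique_at[OF _ has_vector_derivative_const] mink_commute[of "c t" "c' t"]
      by fastforce
  qed
  note orth = this
  have "mink (c t) (c'' t) + mink (c' t) (c' t) = 0" for t
  proof -
    have "((\<lambda>t. mink (c t) (c' t)) has_vector_derivative mink (c t) (c'' t) + mink (c' t) (c' t)) (at t)"
      by (rule mink.has_vector_derivative[OF c1 c2])
    then show ?thesis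
      using vector_derivative_unique_at[OF _ has_vector_derivative_const] by (fastforce simp: orth)
  qed
  then have "mink (c t) (c'' t) = - mink (c' t) (c' t)" for t
    by (simp add: eq_neg_iff_add_eq_0)
  then have acc: "c'' t = (k\<^sup>2 * mink (c' t) (c' t)) *\<^sub>R c t" for t
    using proj[of t] by (simp add: tangent_proj_def)
  have "((\<lambda>t. mink (c' t) (c' t)) has_vector_derivative 0) (at t)" for t
    using mink.has_vector_derivative[OF c2 c2, of t] orth[of t] mink_commute[of "c t" "c' t"]
    by (simp add: acc mink_simps)
  from const_of_vector_derivative_0[OF this] show ?thesis by (simp add: acc)
qed

lemma geo_scaled_derivatives:
  assumes "k > 0"
  shows "((\<lambda>t. geo k p u (r * t)) has_vector_derivative
      r *\<^sub>R ((k * sinh (k * (r * t))) *\<^sub>R p + cosh (k * (r * t)) *\<^sub>R u)) (at t within S)"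
    and "((\<lambda>t. r *\<^sub>R ((k * sinh (k * (r * t))) *\<^sub>R p + cosh (k * (r * t)) *\<^sub>R u)) has_vector_derivative
      (k * r)\<^sup>2 *\<^sub>R geo k p u (r * t)) (at t within S)"
proof -
  have r: "((\<lambda>t. r * t) has_vector_derivative r) (at t within S)"
    by (auto intro!: derivative_eq_intros)
  show "((\<lambda>t. geo k p u (r * t)) has_vector_derivative
      r *\<^sub>R ((k * sinh (k * (r * t))) *\<^sub>R p + cosh (k * (r * t)) *\<^sub>R u)) (at t within S)"
    using vector_diff_chain_within[OF r geo_has_vector_derivative[OF assms]] by (simp add: o_def)
  have "((\<lambda>t. (k * sinh (k * (r * t))) *\<^sub>R p + cosh (k * (r * t)) *\<^sub>R u) has_vector_derivative
      r *\<^sub>R (k\<^sup>2 *\<^sub>R geo k p u (r * t))) (at t within S)"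
    using vector_diff_chain_within[OF r geo_second_derivative[OF assms]] by (simp add: o_def)
  from bounded_linear.has_vector_derivative[OF bounded_linear_scaleR_right this, of r]
  show "((\<lambda>t. r *\<^sub>R ((k * sinh (k * (r * t))) *\<^sub>R p + cosh (k * (r * t)) *\<^sub>R u)) has_vector_derivative
      (k * r)\<^sup>2 *\<^sub>R geo k p u (r * t)) (at t within S)"
    by (simp add: power2_eq_square mult_ac)
qed

text \<open>Existence comes from the reparametrised \<open>geo\<close>; uniqueness holds because
  every competing geodesic solves the same linear equation with coefficient
  \<open>(k * r)\<^sup>2\<close> and the same initial data. The sign of \<open>r\<close> is free, so
  one formula covers the whole line.\<close>

lemma hexp_scaleR:
  assumes "k > 0" "p \<in> hyp_space k" "u \<in> tangent p" "tnorm u = 1"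
  shows "hexp k p (r *\<^sub>R u) = geo k p u r"
  unfolding hexp_def
proof (rule the_equality)
  let ?G = "\<lambda>t. geo k p u (r * t)"
  let ?G' = "\<lambda>t. r *\<^sub>R ((k * sinh (k * (r * t))) *\<^sub>R p + cosh (k * (r * t)) *\<^sub>R u)"
  note G = geo_scaled_derivatives[OF assms(1), where p = p and u = u and r = r]
  have hyp: "?G t \<in> hyp_space k" for t
    by (rule geo_in_hyp[OF assms])
  then have "tangent_proj k (?G t) ((k * r)\<^sup>2 *\<^sub>R ?G t) = 0" for t
    using assms(1) by (simp add: tangent_proj_def mink_simps hyp_space_iff)
  then have "is_geodesic k ?G"
    unfolding is_geodesic_def using hyp G
    by (intro conjI allI exI[of _ ?G'] exI[of _ "\<lambda>t. (k * r)\<^sup>2 *\<^sub>R ?G t"])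
  moreover have "(?G has_vector_derivative r *\<^sub>R u) (at 0)"
    using G(1)[of 0] by simp
  ultimately show "\<exists>c. is_geodesic k c \<and> c 0 = p \<and>
      (c has_vector_derivative r *\<^sub>R u) (at 0) \<and> c 1 = geo k p u r"
    by (intro exI[of _ ?G]) simp
next
  let ?G = "\<lambda>t. geo k p u (r * t)"
  let ?G' = "\<lambda>t. r *\<^sub>R ((k * sinh (k * (r * t))) *\<^sub>R p + cosh (k * (r * t)) *\<^sub>R u)"
  note G = geo_scaled_derivatives[OF assms(1), where p = p and u = u and r = r]
  fix y
  assume "\<exists>c. is_geodesic k c \<and> c 0 = p \<and> (c has_vector_derivative r *\<^sub>R u) (at 0) \<and> c 1 = y"
  then obtain c where c: "is_geodesic k c" "c 0 = p" "(c has_vector_derivative r *\<^sub>R u) (at 0)" "c 1 = y"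
    by blast
  then obtain c' c'' where c': "\<And>t. (c has_vector_derivative c' t) (at t)"
      "\<And>t. (c' has_vector_derivative c'' t) (at t)" "\<And>t. tangent_proj k (c t) (c'' t) = 0"
      "\<And>t. c t \<in> hyp_space k"
    unfolding is_geodesic_def by blast
  have c'0: "c' 0 = r *\<^sub>R u"
    using vector_derivative_unique_at c(3) c'(1) by blast
  then have "mink (c' 0) (c' 0) = r\<^sup>2"
    by (simp add: mink_simps unit_tangent_mink[OF assms(4)] power2_eq_square)
  then have c'': "c'' t = (k * r)\<^sup>2 *\<^sub>R c t" for t
    using geodesic_second_derivative[OF assms(1) c'(4,1,2,3), of t] by (simp add: power_mult_distrib)
  have "c 1 - ?G 1 = 0"
  proof (rule linear_ode_unique[where e = "\<lambda>t. c t - ?G t" and e' = "\<lambda>t. c' t - ?G' t" and a = "k * r"])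
    show "((\<lambda>t. c t - ?G t) has_vector_derivative c' t - ?G' t) (at t)" for t
      by (intro has_vector_derivative_diff c' G)
    have "((\<lambda>t. c' t - ?G' t) has_vector_derivative c'' t - (k * r)\<^sup>2 *\<^sub>R ?G t) (at t)" for t
      by (intro has_vector_derivative_diff c' G)
    then show "((\<lambda>t. c' t - ?G' t) has_vector_derivative (k * r)\<^sup>2 *\<^sub>R (c t - ?G t)) (at t)" for t
      by (simp add: c'' scaleR_diff_right)
  qed (simp_all add: c c'0)
  then show "y = geo k p u r" by (simp add: c)
qed

lemma ray_eq_geo:
  assumes "k > 0" "p \<in> hyp_space k" "u \<in> tangent p" "tnorm u = 1"
  shows "ray k p u = geo k p u"
  by (simp add: fun_eq_iff ray_def hexp_scaleR[OF assms])

lemma exists_unit_tangent_orthogonal: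
  fixes p :: "'n::finite minkowski"
  assumes "k > 0" "p \<in> hyp_space k" "finite S" "card S < CARD('n)"
  obtains u where "u \<in> tangent p" "tnorm u = 1" "\<And>v. v \<in> S \<Longrightarrow> mink v u = 0"
proof -
  \<comment> \<open>Reversing time turns Minkowski orthogonality into Euclidean orthogonality, so a
    dimension count finishes: at most \<open>card S + 1\<close> constraints in dimension n +
    1.\<close>
  define J :: "'n minkowski \<Rightarrow> 'n minkowski" where "J = (\<lambda>x. (- fst x, snd x))"
  have J: "mink x y = J x \<bullet> y" for x y
    by (simp add: J_def mink_def inner_prod_def)
  have "dim (J ` insert p S) \<le> card (J ` insert p S)"
    using assms(3) by (intro dim_le_card') auto
  also have "\<dots> \<le> Suc (card S)"
    using card_image_le[of "insert p S" J] assms(3) by (auto simp: card_insert_if split: if_splits)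
  also have "\<dots> < DIM('n minkowski)" using assms(4) by simp
  finally obtain w where w: "w \<noteq> 0" "\<And>y. y \<in> span (J ` insert p S) \<Longrightarrow> orthogonal w y"
    using orthogonal_to_subspace_exists by metis
  have o: "mink v w = 0" if "v \<in> insert p S" for v
    using w(2)[OF span_base[OF imageI[OF that]]] by (simp add: J orthogonal_def inner_commute)
  then have "w \<in> tangent p" by (simp add: tangent_iff)
  show thesis
  proof (rule that[of "normalize_vec w"])
    show "normalize_vec w \<in> tangent p" by (rule tangent_normalize_vec) fact
    show "tnorm (normalize_vec w) = 1"
      by (rule tnorm_normalize_vec[OF assms(1,2) \<open>w \<in> tangent p\<close> w(1)])
    show "mink v (normalize_vec w) = 0" if "v \<in> S" for v
      using o[of v] that by (simp add: normalize_vec_def mink_simps)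
  qed
qed

text \<open>Here \<open>a\<close> is cosh of k times the distance, and the tangential part of
  \<open>y\<close> has length sinh of the same argument divided by k. The bound
  \<open>a \<ge> 1\<close> puts \<open>a\<close> in the domain of \<open>arcosh\<close>.\<close>

lemma hyp_projection:
  assumes "k > 0" "x \<in> hyp_space k" "y \<in> hyp_space k"
  defines "a \<equiv> - k\<^sup>2 * mink x y"
  shows "y - a *\<^sub>R x \<in> tangent x" "mink (y - a *\<^sub>R x) (y - a *\<^sub>R x) = (a\<^sup>2 - 1) / k\<^sup>2" "a \<ge> 1"
proof -
  have m: "mink x x = - 1 / k\<^sup>2" "mink y y = - 1 / k\<^sup>2" "mink x y = - a / k\<^sup>2" "mink y x = - a / k\<^sup>2"
    using assms mink_commute[of x y] by (auto simp: hyp_space_iff)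
  show t: "y - a *\<^sub>R x \<in> tangent x" by (simp add: tangent_iff mink_simps m)
  show eq: "mink (y - a *\<^sub>R x) (y - a *\<^sub>R x) = (a\<^sup>2 - 1) / k\<^sup>2"
    using assms(1) by (simp add: mink_simps m) (simp add: power2_eq_square field_simps)
  have "a > 0"
    using hyp_mink_less_zero[OF assms(1-3)] assms(1) by (simp add: a_def mult_less_0_iff)
  moreover have "a\<^sup>2 \<ge> 1"
    using tangent_mink_nonneg[OF assms(1,2) t] assms(1) by (simp add: eq zero_le_divide_iff)
  ultimately show "a \<ge> 1" using power2_le_imp_le[of 1 a] by simp
qed

lemma hyp_polar:
  assumes "k > 0" "x \<in> hyp_space k" "y \<in> hyp_space k" "y \<noteq> x"
  obtains u r where "u \<in> tangent x" "tnorm u = 1" "r > 0" "y = geo k x u r"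
proof -
  define a where "a = - k\<^sup>2 * mink x y"
  define w where "w = y - a *\<^sub>R x"
  note P = hyp_projection[OF assms(1-3), folded a_def, folded w_def]
  have "w \<noteq> 0"
  proof
    assume w: "w = 0"
    then have "a\<^sup>2 = 1" using P(2) assms(1) by (simp add: mink_simps)
    then have "a = 1" using P(3) by (simp add: power2_eq_1_iff)
    then show False using w assms(4) by (simp add: w_def)
  qed
  then have "mink w w > 0" by (rule tangent_mink_pos[OF assms(1,2) P(1)])
  then have "a\<^sup>2 > 1" using P(2) assms(1) by (simp add: zero_less_divide_iff)
  then have a: "a > 1" using P(3) by (cases "a = 1") auto
  define s where "s = sqrt (a\<^sup>2 - 1)"
  have s: "s > 0" "tnorm w = s / k"
    using \<open>a\<^sup>2 > 1\<close> assms(1) by (simp_all add: s_def tnorm_def P(2) real_sqrt_divide)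
  have r: "cosh (arcosh a) = a" "sinh (arcosh a) = s"
    using a by (simp_all add: s_def sinh_arcosh_real)
  show thesis
  proof (rule that[of "normalize_vec w" "arcosh a / k"])
    show "normalize_vec w \<in> tangent x" by (rule tangent_normalize_vec[OF P(1)])
    show "tnorm (normalize_vec w) = 1"
      by (rule tnorm_normalize_vec[OF assms(1,2) P(1) \<open>w \<noteq> 0\<close>])
    show "arcosh a / k > 0" using a assms(1) by (simp add: arcosh_real_gt_1_iff)
    show "y = geo k x (normalize_vec w) (arcosh a / k)"
      using assms(1) s r by (simp add: geo_def normalize_vec_def w_def)
  qed
qed

section \<open>The Riemannian distance\<close>

text \<open>For a null vector the space part has norm \<open>\<bar>fst \<xi>\<bar>\<close>.
  Negativity at one point forces \<open>fst \<xi> > 0\<close>, and Cauchy-Schwarz then gives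
  negativity at all points, so the logarithms of the horofunction are defined everywhere.\<close>

lemma future_null_mink_neg:
  assumes "k > 0" "x \<in> hyp_space k" "mink \<xi> \<xi> = 0" "mink x \<xi> < 0" "z \<in> hyp_space k"
  shows "mink z \<xi> < 0"
proof -
  have "(norm (snd \<xi>))\<^sup>2 = (fst \<xi>)\<^sup>2"
    using assms(3) by (simp add: mink_def power2_norm_eq_inner) (simp add: power2_eq_square)
  then have n: "norm (snd \<xi>) = \<bar>fst \<xi>\<bar>"
    by (metis norm_ge_zero power2_abs power2_eq_iff_nonneg abs_ge_zero)
  have less: "norm (snd y) < fst y" if "y \<in> hyp_space k" for y :: "'a minkowski"
    by (rule hyp_norm_snd_less[OF assms(1) that])
  have "fst \<xi> > 0"
  proof (rule ccontr)
    assume "\<not> fst \<xi> > 0"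
    then have "norm (snd \<xi>) = - fst \<xi>" using n by simp
    moreover have "norm (snd x) * norm (snd \<xi>) \<le> fst x * norm (snd \<xi>)"
      using less[OF assms(2)] by (intro mult_right_mono) auto
    ultimately have "norm (snd x) * norm (snd \<xi>) \<le> - (fst x * fst \<xi>)" by simp
    then have "mink x \<xi> \<ge> 0"
      using Cauchy_Schwarz_ineq2[of "snd x" "snd \<xi>"] unfolding mink_def by linarith
    then show False using assms(4) by simp
  qed
  then have "norm (snd z) * norm (snd \<xi>) < fst z * fst \<xi>"
    using less[OF assms(5)] n by simp
  then show ?thesis
    using norm_cauchy_schwarz[of "snd z" "snd \<xi>"] unfolding mink_def by linarith
qed

lemma mink_null_le:
  assumes "k > 0" "z \<in> hyp_space k" "v \<in> tangent z" "mink \<xi> \<xi> = 0"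
  shows "\<bar>mink v \<xi>\<bar> \<le> k * \<bar>mink z \<xi>\<bar> * tnorm v"
proof -
  \<comment> \<open>The orthogonal projection of \<open>\<xi>\<close> to the tangent space at
    \<open>z\<close>. Since \<open>\<xi>\<close> is null, its length is exactly k times
    \<open>\<bar>mink z \<xi>\<bar>\<close>, which is why the horofunction has gradient of norm at
    most 1.\<close>
  define \<eta> where "\<eta> = \<xi> + (k\<^sup>2 * mink z \<xi>) *\<^sub>R z"
  have zz: "mink z z = - 1 / k\<^sup>2" and vz: "mink z v = 0" "mink v z = 0"
    using assms mink_commute[of z v] by (auto simp: hyp_space_iff tangent_iff)
  have "\<eta> \<in> tangent z"
    using assms(1) by (simp add: \<eta>_def tangent_iff mink_simps zz)
  note cs = tangent_Cauchy_Schwarz[OF assms(1-3) this]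
  have "mink v \<eta> = mink v \<xi>" by (simp add: \<eta>_def mink_simps vz)
  moreover have "mink \<eta> \<eta> = (k * mink z \<xi>)\<^sup>2"
    using assms(1,4) mink_commute[of z \<xi>]
    by (simp add: \<eta>_def mink_simps zz) (simp add: power2_eq_square)
  ultimately have "(mink v \<xi>)\<^sup>2 \<le> (k * \<bar>mink z \<xi>\<bar> * tnorm v)\<^sup>2"
    using cs by (simp add: power_mult_distrib tnorm_sq[OF assms(1-3)] mult_ac)
  then have "\<bar>mink v \<xi>\<bar>\<^sup>2 \<le> (k * \<bar>mink z \<xi>\<bar> * tnorm v)\<^sup>2"
    by (simp only: power2_abs)
  moreover have "0 \<le> k * \<bar>mink z \<xi>\<bar> * tnorm v"
    using assms(1) tangent_mink_nonneg[OF assms(1-3)] by (simp add: tnorm_def)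
  ultimately show ?thesis by (rule power2_le_imp_le)
qed

text \<open>The function \<open>z \<mapsto> ln (- k\<^sup>2 * mink z \<xi>) / k\<close> is, up to a constant, the Busemann function of the
  ideal point \<open>\<xi>\<close>.
  Being smooth with gradient of norm at most 1, it bounds lengths from below; unlike
  the distance function it has no singularity at the starting point.\<close>

lemma curve_length_ge_horofunction:
  fixes c :: "real \<Rightarrow> 'n::finite minkowski"
  assumes k: "k > 0" and pw: "c piecewise_C1_differentiable_on {0..1}"
    and int: "(\<lambda>t. tnorm (vector_derivative c (at t))) integrable_on {0..1}"
    and img: "path_image c \<subseteq> hyp_space k"
    and null: "mink \<xi> \<xi> = 0" and neg: "\<And>z. z \<in> hyp_space k \<Longrightarrow> mink z \<xi> < 0"
  shows "ln (- k\<^sup>2 * mink (c 1) \<xi>) / k - ln (- k\<^sup>2 * mink (c 0) \<xi>) / k \<le> curve_length c"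
proof -
  obtain S where cont: "continuous_on {0..1} c" and S: "finite S"
    and C1: "c C1_differentiable_on ({0..1} - S)"
    using pw unfolding piecewise_C1_differentiable_on_def by blast
  obtain D where D: "\<And>t. t \<in> {0..1} - S \<Longrightarrow> (c has_vector_derivative D t) (at t)"
    using C1 unfolding C1_differentiable_on_def by blast
  have hyp: "c t \<in> hyp_space k" if "t \<in> {0..1}" for t
    using img that unfolding path_image_def by blast
  let ?s = "\<lambda>t. tnorm (vector_derivative c (at t))"
  let ?b = "\<lambda>t. ln (- k\<^sup>2 * mink (c t) \<xi>) / k"
  \<comment> \<open>Off the open set of good points the derivative is irrelevant to the integral, so
    it is set equal to the speed there; the comparison of integrands then holds at every
    \<open>t\<close>.\<close>
  define b' where
    "b' = (\<lambda>t. if t \<in> {0<..<1} - S then mink (D t) \<xi> / (k * mink (c t) \<xi>) else ?s t)"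
  have tan: "D t \<in> tangent (c t)" if t: "t \<in> {0<..<1} - S" for t
  proof -
    have c1: "(c has_vector_derivative D t) (at t)" using D t by auto
    have "((\<lambda>t. mink (c t) (c t)) has_vector_derivative mink (c t) (D t) + mink (D t) (c t)) (at t)"
      by (rule mink.has_vector_derivative[OF c1 c1])
    moreover have "((\<lambda>t. mink (c t) (c t)) has_vector_derivative 0) (at t)"
    proof (rule has_vector_derivative_transform_within_open[OF has_vector_derivative_const])
      show "open {0<..<1 :: real}" "t \<in> {0<..<1}" using t by auto
      show "- 1 / k\<^sup>2 = mink (c s) (c s)" if "s \<in> {0<..<1}" for s
        using hyp[of s] that by (simp add: hyp_space_iff)
    qed
    ultimately have "mink (c t) (D t) + mink (D t) (c t) = 0"
      by (rule vector_derivative_unique_at)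
    then show ?thesis using mink_commute[of "c t" "D t"] by (simp add: tangent_iff)
  qed
  have "(b' has_integral (?b 1 - ?b 0)) {0..1}"
  proof (rule fundamental_theorem_of_calculus_interior_strong[OF S])
    have "continuous_on {0..1} (\<lambda>t. mink (c t) \<xi>)"
      using mink.continuous_on[OF cont continuous_on_const] .
    then show "continuous_on {0..1} ?b"
      using k neg hyp by (intro continuous_intros) (auto simp: mult_less_0_iff less_imp_neq)
    fix t assume t: "t \<in> {0<..<1} - S"
    then have c1: "(c has_vector_derivative D t) (at t)" using D by auto
    have "mink (c t) \<xi> < 0" using neg hyp t by auto
    moreover have "((\<lambda>t. mink (c t) \<xi>) has_real_derivative mink (D t) \<xi>) (at t)"
      using mink.has_vector_derivative[OF c1 has_vector_derivative_const, of \<xi>]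
      by (simp add: mink_simps has_real_derivative_iff_has_vector_derivative)
    ultimately have "(?b has_real_derivative mink (D t) \<xi> / (k * mink (c t) \<xi>)) (at t)"
      using k by (auto intro!: derivative_eq_intros simp: mult_less_0_iff zero_less_mult_iff)
    then show "(?b has_vector_derivative b' t) (at t)"
      using t by (simp add: b'_def has_real_derivative_iff_has_vector_derivative)
  qed simp
  moreover have "(?s has_integral curve_length c) {0..1}"
    unfolding curve_length_def by (rule integrable_integral[OF int])
  moreover have "b' t \<le> ?s t" for t
  proof (cases "t \<in> {0<..<1} - S")
    case True
    then have c1: "(c has_vector_derivative D t) (at t)" and h: "c t \<in> hyp_space k"
      using D hyp by auto
    have m: "mink (c t) \<xi> < 0" by (rule neg[OF h])
    have "\<bar>mink (D t) \<xi>\<bar> \<le> k * \<bar>mink (c t) \<xi>\<bar> * tnorm (D t)"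
      by (rule mink_null_le[OF k h tan[OF True] null])
    moreover have "k * \<bar>mink (c t) \<xi>\<bar> > 0" using m by (intro mult_pos_pos k) simp
    ultimately have "\<bar>mink (D t) \<xi>\<bar> / (k * \<bar>mink (c t) \<xi>\<bar>) \<le> tnorm (D t)"
      by (simp only: pos_divide_le_eq mult.commute)
    then have "\<bar>mink (D t) \<xi> / (k * mink (c t) \<xi>)\<bar> \<le> tnorm (D t)"
      by (simp only: abs_divide abs_mult abs_of_pos[OF k])
    then have "mink (D t) \<xi> / (k * mink (c t) \<xi>) \<le> tnorm (D t)" by (rule abs_le_D1)
    moreover have "vector_derivative c (at t) = D t" using c1 by (rule vector_derivative_at)
    ultimately show ?thesis using True by (simp add: b'_def)
  next
    case False
    then show ?thesis unfolding b'_def by (simp only: if_False order_refl)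
  qed
  ultimately show ?thesis by (rule has_integral_le)
qed

lemma hdist_geo:
  assumes "k > 0" "x \<in> hyp_space k" "u \<in> tangent x" "tnorm u = 1" "r \<ge> 0"
  shows "hdist k x (geo k x u r) = r"
  unfolding hdist_def
proof (rule cInf_eq_minimum)
  let ?G = "\<lambda>t. geo k x u (r * t)"
  let ?G' = "\<lambda>t. r *\<^sub>R ((k * sinh (k * (r * t))) *\<^sub>R x + cosh (k * (r * t)) *\<^sub>R u)"
  note G = geo_scaled_derivatives[OF assms(1), where p = x and u = u and r = r]
  have m: "mink x x = - 1 / k\<^sup>2" "mink x u = 0" "mink u x = 0" "mink u u = 1"
    using assms mink_commute[of x u] unit_tangent_mink[of u] by (auto simp: hyp_space_iff tangent_iff)
  have vd: "vector_derivative ?G (at t) = ?G' t" for t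
    by (rule vector_derivative_at[OF G(1)])
  have "tnorm (?G' t) = r" for t
  proof -
    have "mink (?G' t) (?G' t) = r\<^sup>2 * ((cosh (k * (r * t)))\<^sup>2 - (sinh (k * (r * t)))\<^sup>2)"
      using assms(1) by (simp add: mink_simps m) (simp add: power2_eq_square field_simps)
    then show ?thesis
      using assms(5) by (simp add: tnorm_def cosh_sq_minus_sinh_sq)
  qed
  then have speed: "tnorm (vector_derivative ?G (at t)) = r" for t by (simp only: vd)
  have "continuous_on {0..1} ?G'"
    using has_vector_derivative_continuous[OF G(2)] by (simp add: continuous_on_eq_continuous_within)
  then have "?G C1_differentiable_on {0..1}"
    unfolding C1_differentiable_on_def using G(1)[of _ UNIV] by (intro exI[of _ ?G']) auto
  then have "?G piecewise_C1_differentiable_on {0..1}"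
    by (rule C1_differentiable_imp_piecewise)
  moreover have "path_image ?G \<subseteq> hyp_space k"
    using geo_in_hyp[OF assms(1-4)] by (auto simp: path_image_def)
  moreover have "curve_length ?G = r" by (simp add: curve_length_def speed)
  moreover have "(\<lambda>t. tnorm (vector_derivative ?G (at t))) integrable_on {0..1}"
    unfolding speed by (rule integrable_const_ivl)
  moreover have "pathstart ?G = x" "pathfinish ?G = geo k x u r"
    by (simp_all add: pathstart_def pathfinish_def)
  ultimately show "r \<in> {curve_length c | c. c piecewise_C1_differentiable_on {0..1} \<and>
     (\<lambda>t. tnorm (vector_derivative c (at t))) integrable_on {0..1} \<and> path_image c \<subseteq> hyp_space k \<and>
     pathstart c = x \<and> pathfinish c = geo k x u r}"
    by (intro CollectI exI[of _ ?G] conjI) simp_all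
  fix l
  assume "l \<in> {curve_length c | c. c piecewise_C1_differentiable_on {0..1} \<and>
     (\<lambda>t. tnorm (vector_derivative c (at t))) integrable_on {0..1} \<and> path_image c \<subseteq> hyp_space k \<and>
     pathstart c = x \<and> pathfinish c = geo k x u r}"
  then obtain c where c: "l = curve_length c" "c piecewise_C1_differentiable_on {0..1}"
     "(\<lambda>t. tnorm (vector_derivative c (at t))) integrable_on {0..1}" "path_image c \<subseteq> hyp_space k"
     "c 0 = x" "c 1 = geo k x u r"
    by (auto simp: pathstart_def pathfinish_def)
  \<comment> \<open>The null direction of the ideal point behind \<open>x\<close>, reached by the
    geodesic as its parameter tends to minus infinity. Its horofunction grows at rate exactly 1
    along \<open>geo k x u\<close>, so the lower bound is sharp.\<close>
  define \<xi> where "\<xi> = x - (1 / k) *\<^sub>R u"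
  have "mink \<xi> \<xi> = 0"
    using assms(1) by (simp add: \<xi>_def mink_simps m) (simp add: power2_eq_square)
  moreover have x: "mink x \<xi> = - 1 / k\<^sup>2" by (simp add: \<xi>_def mink_simps m)
  then have "mink z \<xi> < 0" if "z \<in> hyp_space k" for z
    using assms(1) \<open>mink \<xi> \<xi> = 0\<close> by (intro future_null_mink_neg[OF assms(1,2) _ _ that]) simp_all
  ultimately have "ln (- k\<^sup>2 * mink (geo k x u r) \<xi>) / k - ln (- k\<^sup>2 * mink x \<xi>) / k \<le> l"
    using curve_length_ge_horofunction[OF assms(1) c(2-4), of \<xi>] by (simp add: c(1,5,6))
  moreover have "- k\<^sup>2 * mink x \<xi> = 1" using assms(1) by (simp add: x)
  moreover have "- k\<^sup>2 * mink (geo k x u r) \<xi> = cosh (k * r) + sinh (k * r)"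
    using assms(1) by (simp add: \<xi>_def geo_def mink_simps m) (simp add: power2_eq_square field_simps)
  moreover have "cosh (k * r) + sinh (k * r) = exp (k * r)" by (rule cosh_plus_sinh)
  ultimately show "r \<le> l" using assms(1) by simp
qed

lemma hdist_eq:
  assumes "k > 0" "x \<in> hyp_space k" "y \<in> hyp_space k"
  shows "hdist k x y = arcosh (- k\<^sup>2 * mink x y) / k"
proof -
  have "\<exists>u r. u \<in> tangent x \<and> tnorm u = 1 \<and> r \<ge> 0 \<and> y = geo k x u r"
  proof (cases "y = x")
    case True
    obtain u where "u \<in> tangent x" "tnorm u = 1"
      using exists_unit_tangent_orthogonal[OF assms(1,2), of "{}"] by auto
    then show ?thesis using True by (intro exI[of _ u] exI[of _ 0]) simp
  next
    case False
    then show ?thesis using hyp_polar[OF assms] by (metis less_imp_le)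
  qed
  then obtain u r where u: "u \<in> tangent x" "tnorm u = 1" "r \<ge> 0" and y: "y = geo k x u r" by blast
  have "- k\<^sup>2 * mink x y = cosh (k * r)"
    using mink_geo_geo[OF assms(1,2) u(1,1), of 0 r] by (simp add: y)
  then show ?thesis
    using assms(1) hdist_geo[OF assms(1,2) u] u(3) by (simp add: y arcosh_cosh_real)
qed

lemma hdist_self:
  assumes "k > 0" "x \<in> hyp_space k"
  shows "hdist k x x = 0"
  using assms hdist_eq[OF assms(1,2,2)] by (simp add: hyp_space_iff)

section \<open>Busemann functions\<close>

text \<open>For large arguments arcosh x is close to ln (2 x), and 2 a cosh s is close to a exp
  s.\<close>

lemma tendsto_arcosh_mult_cosh:
  fixes a :: real
  assumes "a \<ge> 1"
  shows "((\<lambda>s. arcosh (a * cosh s) - s) \<longlongrightarrow> ln a) at_top"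
proof -
  have "arcosh (a * cosh s) = ln (a * cosh s + sqrt ((a * cosh s)\<^sup>2 - 1))" for s
    using assms mult_mono[of 1 a 1 "cosh s"] cosh_real_ge_1[of s] by (intro arcosh_real_def) auto
  moreover have "a > 0" using assms by simp
  then have "((\<lambda>s. ln (a * cosh s + sqrt ((a * cosh s)\<^sup>2 - 1)) - s) \<longlongrightarrow> ln a) at_top"
    unfolding cosh_field_def by real_asymp
  ultimately show ?thesis by simp
qed

text \<open>The condition \<open>mink x u = 0\<close> removes the sinh term, leaving a right-angled
  triangle with cosh (k d) = a cosh (k t). The limit depends on \<open>p\<close> and
  \<open>x\<close> but not on \<open>u\<close>, hence is the same for \<open>u\<close> and
  \<open>- u\<close>.\<close>

lemma busemann_orthogonal:
  assumes "k > 0" "p \<in> hyp_space k" "u \<in> tangent p" "tnorm u = 1"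
    and "x \<in> hyp_space k" "mink x u = 0"
  shows "busemann k p u x = ln (- k\<^sup>2 * mink x p) / k"
proof -
  define a where "a = - k\<^sup>2 * mink x p"
  have "a \<ge> 1" unfolding a_def by (rule hyp_projection(3)[OF assms(1,5,2)])
  have "normalize_vec u = u" using assms(4) by (simp add: normalize_vec_def)
  moreover have "hdist k x (geo k p u t) = arcosh (a * cosh (k * t)) / k" for t
  proof -
    have "- k\<^sup>2 * mink x (geo k p u t) = a * cosh (k * t)"
      using assms(6) by (simp add: geo_def a_def mink_simps)
    then show ?thesis by (simp only: hdist_eq[OF assms(1,5) geo_in_hyp[OF assms(1-4)]])
  qed
  ultimately have eq: "hdist k x (ray k p (normalize_vec u) t) - t =
      (arcosh (a * cosh (k * t)) - k * t) / k" for t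
    using assms(1) by (simp add: ray_eq_geo[OF assms(1-4)] diff_divide_distrib)
  have "filterlim (\<lambda>t. k * t) at_top at_top"
    using assms(1) by real_asymp
  from filterlim_compose[OF tendsto_arcosh_mult_cosh[OF \<open>a \<ge> 1\<close>] this]
  have "((\<lambda>t. (arcosh (a * cosh (k * t)) - k * t) / k) \<longlongrightarrow> ln a / k) at_top"
    by (rule tendsto_divide) (use assms(1) in auto)
  then show ?thesis
    unfolding busemann_def eq a_def by (intro tendsto_Lim) auto
qed

lemma hlog_geo:
  assumes "k > 0" "p \<in> hyp_space k" "u \<in> tangent p" "tnorm u = 1"
  shows "hlog k p (geo k p u r) = r *\<^sub>R u"
proof -
  have inj: "inj_on (hexp k p) (tangent p)"
  proof (rule inj_onI)
    \<comment> \<open>Polar form with nonnegative radius: the distance from \<open>p\<close> then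
      recovers the radius, and the nonzero sinh coefficient recovers the direction.\<close>
    have polar: "\<exists>u r. u \<in> tangent p \<and> tnorm u = 1 \<and> r \<ge> 0 \<and> v = r *\<^sub>R u" if "v \<in> tangent p" for v
    proof (cases "v = 0")
      case True
      then show ?thesis using assms by (intro exI[of _ u] exI[of _ 0]) simp
    next
      case False
      then show ?thesis
        using tnorm_pos[OF assms(1,2) that] that tnorm_normalize_vec[OF assms(1,2) that]
        by (intro exI[of _ "normalize_vec v"] exI[of _ "tnorm v"])
          (simp add: tangent_normalize_vec, simp add: normalize_vec_def)
    qed
    fix v w assume "v \<in> tangent p" "w \<in> tangent p" and eq: "hexp k p v = hexp k p w"
    then obtain a r b s where a: "a \<in> tangent p" "tnorm a = 1" "r \<ge> 0" "v = r *\<^sub>R a"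
      and b: "b \<in> tangent p" "tnorm b = 1" "s \<ge> 0" "w = s *\<^sub>R b"
      using polar by meson
    have e: "geo k p a r = geo k p b s"
      using eq by (simp add: a(4) b(4) hexp_scaleR[OF assms(1,2) a(1,2)] hexp_scaleR[OF assms(1,2) b(1,2)])
    then have rs: "r = s"
      using hdist_geo[OF assms(1,2) a(1-3)] hdist_geo[OF assms(1,2) b(1-3)] by simp
    show "v = w"
    proof (cases "r = 0")
      case False
      then have "sinh (k * r) / k \<noteq> 0" using assms(1) by simp
      then show ?thesis using e by (simp add: a(4) b(4) rs geo_def)
    qed (simp add: a(4) b(4) rs)
  qed
  show ?thesis
    unfolding hlog_def hexp_scaleR[OF assms, symmetric]
    by (rule the_inv_into_f_f[OF inj tangent_scaleR[OF assms(3)]])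
qed

lemma normalize_vec_scaleR_pos:
  assumes "tnorm u = 1" "r > 0"
  shows "normalize_vec (r *\<^sub>R u) = u"
  using assms by (simp add: normalize_vec_def tnorm_scaleR)

lemma busemann_scaleR:
  assumes "tnorm u = 1" "r > 0"
  shows "busemann k p (r *\<^sub>R u) = busemann k p u"
  using normalize_vec_scaleR_pos[OF assms] normalize_vec_scaleR_pos[OF assms(1), of 1]
  by (simp add: busemann_def fun_eq_iff)

text \<open>The coupling uses the ray opposite to the point, in direction \<open>- u\<close>;
  orthogonality to \<open>y\<close> does not see this sign.\<close>

lemma busemann_coupling_geo:
  assumes "k > 0" "p \<in> hyp_space k" "u \<in> tangent p" "tnorm u = 1" "r > 0"
    and "y \<in> hyp_space k" "mink y u = 0"
  shows "busemann_coupling k p (geo k p u r) y = r * (ln (- k\<^sup>2 * mink y p) / k)"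
proof -
  have d: "hdist k p (geo k p u r) = r" using assms(5) by (intro hdist_geo[OF assms(1-4)]) simp
  then have "geo k p u r \<noteq> p" using assms(5) hdist_self[OF assms(1,2)] by auto
  moreover have "busemann k p (- (r *\<^sub>R u)) = busemann k p (- u)"
    using busemann_scaleR[of "- u" r k p] assms(4,5) by (simp add: tnorm_minus)
  moreover have "busemann k p (- u) y = ln (- k\<^sup>2 * mink y p) / k"
    using assms by (intro busemann_orthogonal) (simp_all add: tangent_minus tnorm_minus mink_simps)
  ultimately show ?thesis
    by (simp add: busemann_coupling_def d hlog_geo[OF assms(1-4)])
qed

text \<open>Every tangent direction at \<open>p\<close> is Minkowski-orthogonal to the vector
  \<open>p\<close> itself, so the orthogonal formula applies with \<open>y = p\<close> and gives ln
  1 = 0.\<close>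

lemma busemann_coupling_base:
  assumes "k > 0" "p \<in> hyp_space k" "z \<in> hyp_space k"
  shows "busemann_coupling k p z p = 0"
proof (cases "z = p")
  case True
  then show ?thesis by (simp add: busemann_coupling_def)
next
  case False
  then obtain u r where u: "u \<in> tangent p" "tnorm u = 1" "r > 0" and z: "z = geo k p u r"
    using hyp_polar[OF assms] by metis
  have "- k\<^sup>2 * mink p p = 1" using assms by (simp add: hyp_space_iff)
  then show ?thesis
    using busemann_coupling_geo[OF assms(1,2) u assms(2)] u(1) by (simp add: z tangent_iff)
qed

section \<open>The subdifferential at the base point\<close>

text \<open>With d = 1 - \<open>mink u w\<close>, half the squared length of \<open>u - w\<close>,
  cosh of k times the distance at time t is 1 + d sinh^2 (k t), which is unbounded unless d =
  0.\<close>

lemma asymptotic_geo_unique: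
  assumes "k > 0" "p \<in> hyp_space k" "u \<in> tangent p" "tnorm u = 1" "w \<in> tangent p" "tnorm w = 1"
    and "asymptotic k (geo k p u) (geo k p w)"
  shows "u = w"
proof (rule ccontr)
  assume "u \<noteq> w"
  define d where "d = 1 - mink u w"
  have "u - w \<in> tangent p" using assms(3,5) by (simp add: tangent_iff mink_simps)
  then have "mink (u - w) (u - w) > 0"
    using \<open>u \<noteq> w\<close> by (intro tangent_mink_pos[OF assms(1,2)]) auto
  then have "d > 0"
    using unit_tangent_mink[OF assms(4)] unit_tangent_mink[OF assms(6)] mink_commute[of u w]
    by (simp add: d_def mink_simps)
  obtain B where B: "\<And>t. t \<ge> 0 \<Longrightarrow> \<bar>hdist k (geo k p u t) (geo k p w t)\<bar> \<le> B"
    using assms(7) unfolding asymptotic_def bounded_iff by auto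
  have le: "d * (sinh (k * t))\<^sup>2 \<le> cosh (k * B)" if t: "t \<ge> 0" for t
  proof -
    let ?m = "- k\<^sup>2 * mink (geo k p u t) (geo k p w t)"
    have h: "geo k p u t \<in> hyp_space k" "geo k p w t \<in> hyp_space k"
      using assms by (simp_all add: geo_in_hyp)
    have m: "?m \<ge> 1" by (rule hyp_projection(3)[OF assms(1) h])
    have eq: "?m = 1 + d * (sinh (k * t))\<^sup>2"
      using mink_geo_geo[OF assms(1,2,3,5), of t t] cosh_sq_minus_sinh_sq[of "k * t"]
      by (simp add: d_def power2_eq_square algebra_simps)
    have "arcosh ?m / k \<le> B" using B[OF t] unfolding hdist_eq[OF assms(1) h] by linarith
    then have "arcosh ?m \<le> k * B" using assms(1) by (simp add: divide_le_eq mult.commute)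
    moreover have "arcosh ?m \<ge> 0" using m by (rule arcosh_nonneg_real)
    ultimately have "cosh (arcosh ?m) \<le> cosh (k * B)" by (simp add: cosh_real_nonneg_le_iff)
    then show ?thesis using m eq by simp
  qed
  have "filterlim (\<lambda>t. d * (sinh (k * t))\<^sup>2) at_top at_top"
    using \<open>d > 0\<close> assms(1) by real_asymp
  then have "eventually (\<lambda>t. d * (sinh (k * t))\<^sup>2 > cosh (k * B) \<and> t \<ge> 0) at_top"
    by (intro eventually_conj eventually_ge_at_top) (simp add: filterlim_at_top_dense)
  then obtain t where "d * (sinh (k * t))\<^sup>2 > cosh (k * B)" "t \<ge> 0"
    by (auto dest!: eventually_happens)
  then show False using le[of t] by simp
qed

lemma busemann_point_base:
  assumes "k > 0" "p \<in> hyp_space k" "v \<in> tangent p"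
  shows "busemann_point k p p v = hexp k p v"
proof (cases "v = 0")
  case True
  obtain u where "u \<in> tangent p" "tnorm u = 1"
    using exists_unit_tangent_orthogonal[OF assms(1,2), of "{}"] by auto
  then have "hexp k p 0 = p" using hexp_scaleR[OF assms(1,2), of u 0] by simp
  then show ?thesis using True by (simp add: busemann_point_def)
next
  case False
  \<comment> \<open>At the base point the ray to be matched already starts at \<open>p\<close>, so
    it is its own asymptotic ray. The two minus signs of the definition then cancel.\<close>
  define u where "u = - normalize_vec v"
  have u: "u \<in> tangent p" "tnorm u = 1"
    using assms False by (simp_all add: u_def tangent_minus tangent_normalize_vec tnorm_minus tnorm_normalize_vec)
  have "hdist k (geo k p u t) (geo k p u t) = 0" for t
    by (rule hdist_self[OF assms(1) geo_in_hyp[OF assms(1,2) u]])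
  then have "asymptotic k (geo k p u) (geo k p u)"
    by (simp add: asymptotic_def bounded_iff)
  then have "asymptotic_dir k p p v = u"
    unfolding asymptotic_dir_def u_def[symmetric]
    using u asymptotic_geo_unique[OF assms(1,2) _ _ u]
    by (intro the_equality) (auto simp: ray_eq_geo[OF assms(1,2)])
  then show ?thesis
    using False tnorm_pos[OF assms False] by (simp add: busemann_point_def u_def normalize_vec_def)
qed

text \<open>The minimum at 0 forces derivative 0, yet difference quotients at positive
  \<open>t\<close> are at least \<open>\<beta>\<close>.\<close>

lemma no_vee_minorant_of_differentiable:
  fixes g :: "real \<Rightarrow> real"
  assumes "g differentiable (at 0)" "\<beta> > 0" "\<And>t. g t \<ge> g 0 + \<bar>t\<bar> * \<beta>"
  shows False
proof -
  obtain D where D: "(g has_real_derivative D) (at 0)"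
    using assms(1) real_differentiable_def by blast
  have le: "g 0 \<le> g t" for t
    using assms(3)[of t] mult_nonneg_nonneg[of "\<bar>t\<bar>" \<beta>] assms(2) by linarith
  have "D = 0" using DERIV_local_min[OF D, of 1] le by simp
  then have "((\<lambda>t. (g t - g 0) / t) \<longlongrightarrow> 0) (at 0)"
    using D by (simp add: has_field_derivative_iff)
  then have "eventually (\<lambda>t. \<bar>(g t - g 0) / t\<bar> < \<beta>) (at 0)"
    using assms(2) by (auto dest: tendstoD simp: dist_real_def)
  then obtain e where e: "e > 0" "\<And>t. t \<noteq> 0 \<Longrightarrow> \<bar>t\<bar> < e \<Longrightarrow> \<bar>(g t - g 0) / t\<bar> < \<beta>"
    by (auto simp: eventually_at dist_real_def)
  show False
    using e(2)[of "e / 2"] e(1) assms(3)[of "e / 2"] by (simp add: divide_less_eq abs_less_iff mult.commute)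
qed

lemma busemann_subdiff_base_nonzero:
  fixes p :: "'n::finite minkowski"
  assumes "CARD('n) \<ge> 2" "k > 0" "p \<in> hyp_space k"
    and "f differentiable (at p within hyp_space k)"
    and v: "v \<in> busemann_subdiff k p f p"
  shows "v = 0"
proof (rule ccontr)
  assume "v \<noteq> 0"
  have tv: "v \<in> tangent p" using v by (simp add: busemann_subdiff_def)
  obtain w where w: "w \<in> tangent p" "tnorm w = 1" "mink v w = 0"
    using exists_unit_tangent_orthogonal[OF assms(2,3), of "{v}"] assms(1) by auto
  define n where "n = normalize_vec v"
  define s where "s = tnorm v"
  have n: "n \<in> tangent p" "tnorm n = 1" and s: "s > 0" and vn: "v = s *\<^sub>R n"
    using tv \<open>v \<noteq> 0\<close> assms(2,3) tnorm_pos[OF assms(2,3) tv \<open>v \<noteq> 0\<close>]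
    by (simp_all add: n_def s_def tangent_normalize_vec tnorm_normalize_vec) (simp add: normalize_vec_def)
  define y where "y = geo k p n s"
  have y: "y \<in> hyp_space k" unfolding y_def by (rule geo_in_hyp[OF assms(2,3) n])
  have "mink n w = 0" using w(3) s by (simp add: vn mink_simps)
  then have yw: "mink y w = 0" using w(1) by (simp add: y_def geo_def mink_simps tangent_iff)
  have pt: "busemann_point k p p v = y"
    unfolding busemann_point_base[OF assms(2,3) tv] y_def
    unfolding vn by (rule hexp_scaleR[OF assms(2,3) n])
  define \<beta> where "\<beta> = ln (- k\<^sup>2 * mink y p) / k"
  have "- k\<^sup>2 * mink y p = cosh (k * s)"
    using mink_geo_geo[OF assms(2,3) n(1,1), of s 0] by (simp add: y_def)
  moreover have "cosh (k * s) > cosh 0" using assms(2) s by (intro cosh_real_strict_mono) auto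
  ultimately have "\<beta> > 0" using assms(2) by (simp add: \<beta>_def)
  \<comment> \<open>Negative \<open>t\<close> is read as positive radius \<open>- t\<close> in
    direction \<open>- w\<close>; at \<open>t = 0\<close> the coupling takes its default value
    0.\<close>
  have coupling: "busemann_coupling k p (geo k p w t) y = \<bar>t\<bar> * \<beta>" for t
  proof (cases t "0 :: real" rule: linorder_cases)
    case greater
    then show ?thesis
      using busemann_coupling_geo[OF assms(2,3) w(1,2) greater y yw] by (simp add: \<beta>_def)
  next
    case less
    have "geo k p w t = geo k p (- w) (- t)" by (simp add: geo_def)
    then show ?thesis
      using busemann_coupling_geo[OF assms(2,3) tangent_minus[OF w(1)], of "- t" y] less w(2) y yw
      by (simp add: \<beta>_def tnorm_minus mink_simps)
  qed (simp add: busemann_coupling_def)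
  have hyp: "geo k p w t \<in> hyp_space k" for t by (rule geo_in_hyp[OF assms(2,3) w(1,2)])
  let ?g = "\<lambda>t. f (geo k p w t)"
  have "?g t \<ge> ?g 0 + \<bar>t\<bar> * \<beta>" for t
  proof -
    have "busemann_coupling k p p y = 0" by (simp add: busemann_coupling_def)
    then show ?thesis using v hyp[of t] coupling[of t] by (auto simp: busemann_subdiff_def pt)
  qed
  moreover have "?g differentiable (at 0)"
  proof -
    have "geo k p w differentiable (at 0)"
      using geo_has_vector_derivative[OF assms(2)] differentiableI_vector by blast
    \<comment> \<open>Differentiability of \<open>f\<close> is relative to the hyperboloid, so it is
      restricted to the range of the geodesic before the chain rule is applied.\<close>
    moreover have "f differentiable (at (geo k p w 0) within range (geo k p w))"
      using assms(4) hyp by (auto intro: differentiable_within_subset)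
    ultimately show ?thesis using differentiable_chain_within[of "geo k p w" 0 UNIV f] by (simp add: o_def)
  qed
  ultimately show False using no_vee_minorant_of_differentiable[of ?g \<beta>] \<open>\<beta> > 0\<close> by blast
qed

theorem theorem20:
  fixes k :: real and p :: "real \<times> (real ^ 'n::finite)" and f :: "real \<times> (real ^ 'n) \<Rightarrow> real"
  assumes "CARD('n) \<ge> 2"
    and "k > 0"
    and "p \<in> hyp_space k"
    and "f differentiable (at p within hyp_space k)"
  shows "busemann_subdiff k p f p =
           (if p \<in> {z. is_arg_min f (\<lambda>w. w \<in> hyp_space k) z} then {0} else {})"
proof -
  have "v \<in> busemann_subdiff k p f p \<longleftrightarrow> v = 0 \<and> (\<forall>z \<in> hyp_space k. f z \<ge> f p)" for v
  proof (cases "v = 0")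
    case True
    have "0 \<in> tangent p" by (simp add: tangent_iff mink_simps)
    moreover have "busemann_point k p p 0 = p" by (simp add: busemann_point_def)
    ultimately show ?thesis
      using True by (simp add: busemann_subdiff_def busemann_coupling_base[OF assms(2,3)] assms(3))
  next
    case False
    then show ?thesis using busemann_subdiff_base_nonzero[OF assms] by blast
  qed
  then have "busemann_subdiff k p f p = (if \<forall>z \<in> hyp_space k. f z \<ge> f p then {0} else {})"
    by (simp add: set_eq_iff del: split_paired_All)
  moreover have "(\<forall>z \<in> hyp_space k. f z \<ge> f p) \<longleftrightarrow> is_arg_min f (\<lambda>w. w \<in> hyp_space k) p"
    unfolding is_arg_min_def using assms(3) by (meson not_less)
  ultimately show ?thesis by simp
qed

end
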